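(* Let $\mathbb F_q$ be a finite field with $q$ elements, let $n\ge 0$, let $\mathbf w=(w_0,\dots,w_n)$ be a vector of positive integers, and let $T=\{0,\dots,n\}$. Let $A_{\mathbf w}(q)$ be the number of orbits of $\mathbb F_q^\times$ on $\mathbb F_q^{n+1}\setminus\{0\}$ under the weighted action $\lambda\cdot(x_0,\dots,x_n)=(\lambda^{w_0}x_0,\dots,\lambda^{w_n}x_n)$. For $\lambda\in\mathbb F_q^\times$ set $N(\lambda)=\#\{i\in T:\lambda^{w_i}=1\}$, and for $\emptyset\ne S\subseteq T$ set $k_S=\gcd\{w_i:i\in S\}$. Then $$A_{\mathbf w}(q)=\frac1{q-1}\sum_{\lambda\in\mathbb F_q^\times}\bigl(q^{N(\lambda)}-1\bigr)=\sum_{\emptyset\ne S\subseteq T}(q-1)^{|S|-1}\gcd(k_S,q-1).$$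
   Context: All notation is introduced in the statement. *)

theory Defs
  imports "HOL-Algebra.Group_Action" "HOL-Algebra.Multiplicative_Group"
begin

text \<open>Points of the affine space of dimension \<open>n + 1\<close> are extensional functions on \<open>{0..n}\<close>.\<close>

definition nonzero_tuples :: "('a, 'm) ring_scheme \<Rightarrow> nat \<Rightarrow> (nat \<Rightarrow> 'a) set" where
  "nonzero_tuples R n = ({0..n} \<rightarrow>\<^sub>E carrier R) - {\<lambda>i\<in>{0..n}. \<zero>\<^bsub>R\<^esub>}"

text \<open>The action is restricted to the nonzero tuples since \<open>group_action\<close> uses extensional
  permutations.\<close>

definition weighted_action ::
    "('a, 'm) ring_scheme \<Rightarrow> nat \<Rightarrow> (nat \<Rightarrow> nat) \<Rightarrow> 'a \<Rightarrow> (nat \<Rightarrow> 'a) \<Rightarrow> nat \<Rightarrow> 'a" where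
  "weighted_action R n w a =
     (\<lambda>x\<in>nonzero_tuples R n. \<lambda>i\<in>{0..n}. (a [^]\<^bsub>R\<^esub> w i) \<otimes>\<^bsub>R\<^esub> x i)"

definition weighted_orbit_count :: "('a, 'm) ring_scheme \<Rightarrow> nat \<Rightarrow> (nat \<Rightarrow> nat) \<Rightarrow> nat" where
  "weighted_orbit_count R n w =
     card (orbits (mult_of R) (nonzero_tuples R n) (weighted_action R n w))"

definition trivial_weight_count :: "('a, 'm) ring_scheme \<Rightarrow> nat \<Rightarrow> (nat \<Rightarrow> nat) \<Rightarrow> 'a \<Rightarrow> nat" where
  "trivial_weight_count R n w a = card {i \<in> {0..n}. a [^]\<^bsub>R\<^esub> w i = \<one>\<^bsub>R\<^esub>}"

lemma (in field) weighted_action_closed: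
  assumes l: "l \<in> carrier (mult_of R)" and x: "x \<in> nonzero_tuples R n"
  shows "weighted_action R n w l x \<in> nonzero_tuples R n"
proof -
  have lc: "l \<in> carrier R" "l \<noteq> \<zero>" using l by auto
  have pw: "l [^] (k::nat) \<in> carrier R" "l [^] k \<noteq> \<zero>" for k
    using Units_pow_closed[of l k] lc by (auto simp: field_Units)
  have xc: "x i \<in> carrier R" if "i \<in> {0..n}" for i
    using x that by (auto simp: nonzero_tuples_def PiE_def Pi_def)
  have ex: "\<exists>i\<in>{0..n}. x i \<noteq> \<zero>"
  proof (rule ccontr)
    assume "\<not> ?thesis"
    hence "x = (\<lambda>i\<in>{0..n}. \<zero>)"
      using x by (auto simp: nonzero_tuples_def PiE_def extensional_def fun_eq_iff restrict_def)
    thus False using x by (simp add: nonzero_tuples_def)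
  qed
  then obtain i where i: "i \<in> {0..n}" "x i \<noteq> \<zero>" by blast
  have "l [^] w i \<otimes> x i \<noteq> \<zero>"
    using integral_iff[OF pw(1) xc[OF i(1)]] i(2) pw(2) by simp
  hence "(\<lambda>i\<in>{0..n}. l [^] w i \<otimes> x i) \<noteq> (\<lambda>i\<in>{0..n}. \<zero>)"
    using i(1) by (auto dest!: fun_cong[where x = i])
  thus ?thesis
    using x pw(1) xc by (simp add: weighted_action_def) (simp add: nonzero_tuples_def)
qed

lemma (in field) weighted_action_mult:
  assumes "l \<in> carrier (mult_of R)" "m \<in> carrier (mult_of R)" "x \<in> nonzero_tuples R n"
  shows "weighted_action R n w (l \<otimes> m) x = weighted_action R n w l (weighted_action R n w m x)"
proof -
  have xc: "x i \<in> carrier R" if "i \<in> {0..n}" for i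
    using assms(3) that by (auto simp: nonzero_tuples_def PiE_def Pi_def)
  have "(l \<otimes> m) [^] w i \<otimes> x i = l [^] w i \<otimes> (m [^] w i \<otimes> x i)" if "i \<in> {0..n}" for i
    using assms xc[OF that] by (simp add: nat_pow_distrib m_assoc)
  moreover have "weighted_action R n w m x \<in> nonzero_tuples R n"
    using assms by (intro weighted_action_closed)
  ultimately show ?thesis
    using assms(3) unfolding weighted_action_def by (simp cong: restrict_cong)
qed

lemma (in field) weighted_action_one:
  assumes "x \<in> nonzero_tuples R n"
  shows "weighted_action R n w \<one> x = x"
proof -
  have "x i \<in> carrier R" if "i \<in> {0..n}" for i
    using assms that by (auto simp: nonzero_tuples_def PiE_def Pi_def)
  moreover have "x \<in> extensional {0..n}"
    using assms by (simp add: nonzero_tuples_def PiE_def)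
  ultimately show ?thesis
    using assms
    by (intro extensionalityI[where A = "{0..n}"]) (simp_all add: weighted_action_def)
qed

lemma (in field) weighted_action_is_group_action:
  "group_action (mult_of R) (nonzero_tuples R n) (weighted_action R n w)"
proof -
  let ?E = "nonzero_tuples R n" and ?a = "weighted_action R n w"
  interpret M: group "mult_of R" by (rule field_mult_group)
  have bij: "?a l \<in> Bij ?E" if l: "l \<in> carrier (mult_of R)" for l
  proof -
    let ?i = "inv\<^bsub>mult_of R\<^esub> l"
    have i: "?i \<in> carrier (mult_of R)" using l by (rule M.inv_closed)
    have "?i \<otimes> l = \<one>" "l \<otimes> ?i = \<one>" using M.l_inv[OF l] M.r_inv[OF l] by simp_all
    hence "?a ?i (?a l x) = x" "?a l (?a ?i x) = x" if "x \<in> ?E" for x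
      using weighted_action_mult[OF i l that, of w] weighted_action_mult[OF l i that, of w]
        weighted_action_one[OF that, of w] by simp_all
    hence "bij_betw (?a l) ?E ?E"
      using weighted_action_closed[OF l] weighted_action_closed[OF i]
      by (intro bij_betw_byWitness[where f' = "?a ?i"]) auto
    thus ?thesis by (simp add: Bij_def weighted_action_def)
  qed
  have "?a (l \<otimes> m) = compose ?E (?a l) (?a m)"
    if "l \<in> carrier (mult_of R)" "m \<in> carrier (mult_of R)" for l m
    using weighted_action_mult[OF that, of _ n w]
    by (intro extensionalityI[where A = ?E]) (auto simp: weighted_action_def compose_def)
  hence "?a \<in> hom (mult_of R) (BijGroup ?E)"
    using bij by (auto simp: hom_def BijGroup_def)
  thus ?thesis
    by (simp add: group_action_def group_hom_def group_hom_axioms_def M.group_axioms group_BijGroup)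
qed

end

theory Submission
  imports Defs
begin

text \<open>
  Burnside's lemma gives the first formula, as the tuples fixed by \<open>\<lambda>\<close> are those supported on the
  \<open>N(\<lambda>)\<close> indices with \<open>\<lambda> ^ w\<^sub>i = 1\<close>. Expanding \<open>q\<^sup>N = (1 + (q - 1))\<^sup>N\<close> over the subsets of these
  indices and exchanging the sums leaves, for each \<open>S\<close>, the number of \<open>\<lambda>\<close> with \<open>\<lambda>\<^sup>k = 1\<close> for
  \<open>k = k\<^sub>S\<close>, which is \<open>gcd k (q - 1)\<close> because the multiplicative group is cyclic of order \<open>q - 1\<close>.
\<close>

text \<open>Multiply out the product of \<open>card A\<close> factors c + 1: the subset X records
  the factors from which c is chosen.\<close>

lemma sum_Pow_power_card:
  fixes c :: "'b::comm_semiring_1"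
  assumes "finite A"
  shows "(\<Sum>X\<in>Pow A. c ^ card X) = (c + 1) ^ card A"
  using prod_add[OF assms, of "\<lambda>_. c" "\<lambda>_. 1"] by simp

text \<open>Write the order as e * d with d = gcd k (order G). A power g^i of the generator is
  killed by k exactly when e divides i, and modulo the order there are d such exponents: e * j with
  j < d. The case k = 0 is covered, with e = 1.\<close>

lemma (in group) card_torsion_cyclic:
  fixes k :: nat
  assumes fin: "finite (carrier G)" and g: "g \<in> carrier G"
    and gen: "carrier G = {g [^] i | i::nat. i \<in> UNIV}"
  shows "card {x \<in> carrier G. x [^] k = \<one>} = gcd k (order G)"
proof -
  define d where "d = gcd k (order G)"
  define e where "e = order G div d"
  have m: "order G > 0" using fin by (simp add: order_gt_0_iff_finite)
  have d: "d > 0" using m by (simp add: d_def)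
  have ed: "e * d = order G" by (simp add: e_def d_def)
  have e: "e > 0" using m ed by (cases e) auto
  have ord_g: "ord g = order G"
    using generate_pow_card[OF g] generate_pow_on_finite_carrier[OF fin g] gen
    by (simp add: order_def)
  obtain k' where k': "k = k' * d" "coprime k' e"
  proof -
    have "coprime (k div d) e"
      unfolding e_def d_def using m by (intro div_gcd_coprime) auto
    thus ?thesis using that[of "k div d"] by (simp add: d_def)
  qed
  have iff: "(g [^] i) [^] k = \<one> \<longleftrightarrow> e dvd i" for i :: nat
  proof -
    have "(g [^] i) [^] k = \<one> \<longleftrightarrow> e * d dvd (i * k') * d"
      using g by (simp add: nat_pow_pow pow_eq_id ord_g ed k' mult.assoc)
    also have "\<dots> \<longleftrightarrow> e dvd i * k'" using d by simp
    also have "\<dots> \<longleftrightarrow> e dvd i"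
      using k'(2) by (simp add: coprime_dvd_mult_left_iff coprime_commute)
    finally show ?thesis .
  qed
  have "bij_betw (\<lambda>j. g [^] (e * j)) {..<d} {x \<in> carrier G. x [^] k = \<one>}"
  proof (rule bij_betw_imageI)
    show "inj_on (\<lambda>j. g [^] (e * j)) {..<d}"
    proof (rule inj_onI)
      fix i j assume ij: "i \<in> {..<d}" "j \<in> {..<d}" "g [^] (e * i) = g [^] (e * j)"
      have "e * i < order G" "e * j < order G"
        using ij(1,2) e by (simp_all flip: ed)
      \<comment> \<open>The form needed by \<open>ord_inj\<close>, which gives injectivity on the
        closed range from 0 to \<open>ord g - 1\<close>.\<close>
      hence "e * i \<le> order G - 1" "e * j \<le> order G - 1" by linarith+
      hence "e * i = e * j"
        using ord_inj[OF g] ij(3) unfolding ord_g by (auto dest: inj_onD)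
      thus "i = j" using e by simp
    qed
    show "(\<lambda>j. g [^] (e * j)) ` {..<d} = {x \<in> carrier G. x [^] k = \<one>}"
    proof (intro equalityI subsetI)
      fix x assume "x \<in> (\<lambda>j. g [^] (e * j)) ` {..<d}"
      then obtain j where "x = g [^] (e * j)" by blast
      thus "x \<in> {x \<in> carrier G. x [^] k = \<one>}" using g iff[of "e * j"] by simp
    next
      fix x assume x: "x \<in> {x \<in> carrier G. x [^] k = \<one>}"
      hence "x \<in> {g [^] i | i::nat. i \<in> UNIV}" unfolding gen[symmetric] by simp
      then obtain i :: nat where i: "x = g [^] i" by blast
      with x have "e dvd i" using iff[of i] by simp
      then obtain j where "i = e * j" by (rule dvdE)
      \<comment> \<open>Changing j by a multiple of d changes e * j by a multiple of e * d, the
        order of g.\<close>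
      moreover have "g [^] (e * j) = g [^] (e * (j mod d))"
      proof -
        have "e * j = e * (d * (j div d) + j mod d)" by simp
        hence "e * j = order G * (j div d) + e * (j mod d)"
          unfolding ed[symmetric] distrib_left mult.assoc .
        hence "g [^] (e * j) = g [^] (order G * (j div d)) \<otimes> g [^] (e * (j mod d))"
          using g by (simp add: nat_pow_mult)
        also have "g [^] (order G * (j div d)) = \<one>"
          using g by (simp add: pow_eq_id ord_g)
        finally show ?thesis using g by simp
      qed
      ultimately have "x = g [^] (e * (j mod d))" using i by simp
      thus "x \<in> (\<lambda>j. g [^] (e * j)) ` {..<d}" using d by (intro image_eqI[of _ _ "j mod d"]) simp_all
    qed
  qed
  from bij_betw_same_card[OF this] show ?thesis by (simp add: d_def)
qed

lemma (in field) card_roots_of_unity: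
  fixes k :: nat
  assumes "finite (carrier R)"
  shows "card {a \<in> carrier (mult_of R). a [^] k = \<one>} = gcd k (order R - 1)"
proof -
  interpret M: group "mult_of R" by (rule field_mult_group)
  obtain g where g: "g \<in> carrier (mult_of R)"
    and gen: "carrier (mult_of R) = {g [^] i | i::nat. i \<in> UNIV}"
    using finite_field_mult_group_has_gen[OF assms] by blast
  show ?thesis
    using M.card_torsion_cyclic[OF finite_mult_of[OF assms] g, of k, unfolded nat_pow_mult_of, OF gen]
    by (simp only: one_mult_of order_mult_of[OF assms])
qed

lemma (in field) card_weighted_invariants:
  assumes fin: "finite (carrier R)" and a: "a \<in> carrier (mult_of R)"
  shows "card (invariants (nonzero_tuples R n) (weighted_action R n w) a) =
    order R ^ trivial_weight_count R n w a - 1"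
proof -
  \<comment> \<open>\<open>B i\<close> is the set of values that a fixed point may take at i: a
    nonzero y can be cancelled from a^(w i) y = y, forcing a^(w i) = 1.\<close>
  define B where "B i = (if a [^] w i = \<one> then carrier R else {\<zero>})" for i
  have ac: "a \<in> carrier R" using a by simp
  have fix_iff: "a [^] w i \<otimes> y = y \<longleftrightarrow> y \<in> B i" if y: "y \<in> carrier R" for i y
  proof -
    have "a [^] w i \<otimes> y = y \<longleftrightarrow> a [^] w i \<otimes> y = \<one> \<otimes> y" using y by simp
    also have "\<dots> \<longleftrightarrow> y = \<zero> \<or> a [^] w i = \<one>"
      using m_rcancel[of y "a [^] w i" \<one>] y ac by (cases "y = \<zero>") auto
    finally show ?thesis using y by (auto simp: B_def)
  qed
  have B_sub: "B i \<subseteq> carrier R" for i by (auto simp: B_def)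
  \<comment> \<open>Removing the zero tuple from the product of the \<open>B i\<close> therefore
    lowers the cardinality by exactly one.\<close>
  have zero_mem: "(\<lambda>i\<in>{0..n}. \<zero>) \<in> PiE {0..n} B" by (auto simp: B_def)
  have fixed_point: "weighted_action R n w a x = x \<longleftrightarrow> x \<in> PiE {0..n} B"
    if x: "x \<in> nonzero_tuples R n" for x
  proof -
    have x': "x \<in> extensional {0..n}" "\<And>i. i \<in> {0..n} \<Longrightarrow> x i \<in> carrier R"
      using x by (auto simp: nonzero_tuples_def PiE_def Pi_def)
    have "weighted_action R n w a x = x \<longleftrightarrow> (\<forall>i\<in>{0..n}. a [^] w i \<otimes> x i = x i)"
      using x x'(1) by (auto simp: weighted_action_def fun_eq_iff restrict_def extensional_def)
    thus ?thesis using x' fix_iff by (auto simp: PiE_def Pi_def)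
  qed
  have "invariants (nonzero_tuples R n) (weighted_action R n w) a =
      PiE {0..n} B - {\<lambda>i\<in>{0..n}. \<zero>}"
    using fixed_point PiE_mono[of "{0..n}" B "\<lambda>_. carrier R"] B_sub
    by (auto simp: invariants_def nonzero_tuples_def)
  hence "card (invariants (nonzero_tuples R n) (weighted_action R n w) a) =
      card (PiE {0..n} B) - 1"
    using zero_mem by simp
  also have "card (PiE {0..n} B) = (\<Prod>i\<in>{0..n}. if a [^] w i = \<one> then order R else 1)"
    by (simp add: card_PiE B_def order_def if_distrib cong: prod.cong if_cong)
  also have "\<dots> = order R ^ trivial_weight_count R n w a"
    unfolding trivial_weight_count_def by (subst prod.inter_filter[symmetric]) simp_all
  finally show ?thesis .
qed

text \<open>Burnside's lemma in multiplied-out form, so that it stays in \<open>nat\<close>; the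
  subtractions do not truncate, since the order of a finite field is positive.\<close>

lemma (in field) weighted_orbit_count_burnside:
  assumes fin: "finite (carrier R)"
  shows "weighted_orbit_count R n w * (order R - 1) =
    (\<Sum>a\<in>carrier (mult_of R). order R ^ trivial_weight_count R n w a - 1)"
proof -
  interpret A: group_action "mult_of R" "nonzero_tuples R n" "weighted_action R n w"
    by (rule weighted_action_is_group_action)
  have "finite (nonzero_tuples R n)"
    using fin by (simp add: nonzero_tuples_def finite_PiE)
  thus ?thesis
    using A.burnside[OF finite_mult_of[OF fin]] card_weighted_invariants[OF fin]
    by (simp add: weighted_orbit_count_def order_mult_of[OF fin])
qed

text \<open>Both sides say that the order of a divides every weight indexed by S.\<close>

lemma (in field) all_pow_eq_one_iff:
  assumes "a \<in> carrier (mult_of R)"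
  shows "(\<forall>i\<in>S. a [^] (w i :: nat) = \<one>) \<longleftrightarrow> a [^] Gcd (w ` S) = \<one>"
proof -
  interpret M: group "mult_of R" by (rule field_mult_group)
  show ?thesis
    using M.pow_eq_id[OF assms] by (simp add: nat_pow_mult_of dvd_Gcd_iff)
qed

text \<open>Here c stands for q - 1. Working in a commutative ring with c + 1 as the base makes the
  subset expansion direct and avoids truncated subtraction.\<close>

lemma (in field) sum_power_trivial_weight_count:
  fixes c :: "'c::comm_ring_1"
  assumes fin: "finite (carrier R)"
  shows "(\<Sum>a\<in>carrier (mult_of R). (c + 1) ^ trivial_weight_count R n w a - 1) =
    (\<Sum>S\<in>{S. S \<noteq> {} \<and> S \<subseteq> {0..n}}. c ^ card S * of_nat (gcd (Gcd (w ` S)) (order R - 1)))"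
proof -
  let ?T = "{S. S \<noteq> {} \<and> S \<subseteq> {0..n}}" and ?G = "carrier (mult_of R)"
  have finT: "finite ?T" by (rule finite_subset[of _ "Pow {0..n}"]) auto
  have finG: "finite ?G" by (rule finite_mult_of[OF fin])
  have "(c + 1) ^ trivial_weight_count R n w a - 1 =
      (\<Sum>S\<in>?T. if a [^] Gcd (w ` S) = \<one> then c ^ card S else 0)" if a: "a \<in> ?G" for a
  proof -
    let ?A = "{i \<in> {0..n}. a [^] w i = \<one>}"
    have "(c + 1) ^ trivial_weight_count R n w a = (\<Sum>S\<in>Pow ?A. c ^ card S)"
      by (subst sum_Pow_power_card) (simp_all add: trivial_weight_count_def)
    \<comment> \<open>The empty subset contributes the 1 that cancels the - 1, leaving only nonempty
      S.\<close>
    also have "\<dots> = 1 + (\<Sum>S\<in>Pow ?A - {{}}. c ^ card S)"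
      by (subst sum.remove[of _ "{}"]) auto
    also have "Pow ?A - {{}} = {S \<in> ?T. a [^] Gcd (w ` S) = \<one>}"
      using all_pow_eq_one_iff[OF a, of _ w] by blast
    \<comment> \<open>Turning the condition on S into an indicator gives an index set independent of
      a, so that the two sums can be swapped.\<close>
    also have "(\<Sum>S\<in>\<dots>. c ^ card S) = (\<Sum>S\<in>?T. if a [^] Gcd (w ` S) = \<one> then c ^ card S else 0)"
      by (rule sum.inter_filter[OF finT])
    finally show ?thesis by simp
  qed
  hence "(\<Sum>a\<in>?G. (c + 1) ^ trivial_weight_count R n w a - 1) =
      (\<Sum>a\<in>?G. \<Sum>S\<in>?T. if a [^] Gcd (w ` S) = \<one> then c ^ card S else 0)"
    by (intro sum.cong) simp_all
  also have "\<dots> = (\<Sum>S\<in>?T. \<Sum>a\<in>?G. if a [^] Gcd (w ` S) = \<one> then c ^ card S else 0)"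
    by (rule sum.swap)
  also have "\<dots> = (\<Sum>S\<in>?T. c ^ card S * of_nat (card {a \<in> ?G. a [^] Gcd (w ` S) = \<one>}))"
    by (intro sum.cong refl, subst sum.inter_filter[OF finG, symmetric]) (simp add: mult.commute)
  finally show ?thesis by (simp only: card_roots_of_unity[OF fin])
qed

theorem theorem3p4:
  fixes R (structure) and q n :: nat and w :: "nat \<Rightarrow> nat"
  assumes "field R" and "finite (carrier R)" and "order R = q"
    and "\<And>i. i \<in> {0..n} \<Longrightarrow> 0 < w i"
  shows "real (weighted_orbit_count R n w) =
           1 / (real q - 1) *
             (\<Sum>a\<in>carrier (Multiplicative_Group.mult_of R). (real q ^ trivial_weight_count R n w a - 1))
       \<and> 1 / (real q - 1) *
             (\<Sum>a\<in>carrier (Multiplicative_Group.mult_of R). (real q ^ trivial_weight_count R n w a - 1)) =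
           (\<Sum>S\<in>{S. S \<noteq> {} \<and> S \<subseteq> {0..n}}.
             (real q - 1) ^ (card S - 1) * real (gcd (Gcd (w ` S)) (q - 1)))"
proof -
  interpret field R by fact
  note fin = assms(2) and q = assms(3)
  let ?T = "{S. S \<noteq> {} \<and> S \<subseteq> {0..n}}" and ?G = "carrier (mult_of R)"
  \<comment> \<open>Since 0 and 1 differ, q - 1 is nonzero: it can be divided by in the reals, and
    casting it from \<open>nat\<close> is harmless.\<close>
  have q2: "q > 1"
  proof -
    have "card {\<zero>, \<one>} \<le> card (carrier R)" by (rule card_mono[OF fin]) auto
    thus ?thesis using q by (simp add: order_def)
  qed
  have "real (weighted_orbit_count R n w) * (real q - 1) =
      real (weighted_orbit_count R n w * (q - 1))"
    using q2 by (simp add: of_nat_diff)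
  also have "\<dots> = (\<Sum>a\<in>?G. real (q ^ trivial_weight_count R n w a - 1))"
    using weighted_orbit_count_burnside[OF fin, of n w] by (simp only: q of_nat_sum)
  also have "\<dots> = (\<Sum>a\<in>?G. real q ^ trivial_weight_count R n w a - 1)"
    using q2 by (intro sum.cong) (simp_all add: of_nat_diff)
  finally have orbits: "real (weighted_orbit_count R n w) * (real q - 1) = \<dots>" .
  have "(\<Sum>a\<in>?G. real q ^ trivial_weight_count R n w a - 1) =
      (\<Sum>S\<in>?T. (real q - 1) ^ card S * real (gcd (Gcd (w ` S)) (q - 1)))"
    using sum_power_trivial_weight_count[OF fin, of "real q - 1" n w] q by simp
  \<comment> \<open>One factor q - 1 splits off because S is nonempty and finite, so
    \<open>card S - 1\<close> is a true predecessor. It cancels against the denominator at the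
    end.\<close>
  also have "\<dots> = (\<Sum>S\<in>?T. (real q - 1) *
      ((real q - 1) ^ (card S - 1) * real (gcd (Gcd (w ` S)) (q - 1))))"
  proof (rule sum.cong[OF refl])
    fix S assume "S \<in> ?T"
    hence "card S \<noteq> 0" using finite_subset[of S "{0..n}"] by auto
    thus "(real q - 1) ^ card S * real (gcd (Gcd (w ` S)) (q - 1)) =
        (real q - 1) * ((real q - 1) ^ (card S - 1) * real (gcd (Gcd (w ` S)) (q - 1)))"
      by (cases "card S") simp_all
  qed
  finally have "(\<Sum>a\<in>?G. real q ^ trivial_weight_count R n w a - 1) = (real q - 1) *
      (\<Sum>S\<in>?T. (real q - 1) ^ (card S - 1) * real (gcd (Gcd (w ` S)) (q - 1)))"
    by (simp only: sum_distrib_left)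
  with orbits q2 show ?thesis by (simp add: field_simps)
qed

end
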